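(* Let $x_0(t)$ be the quasi-periodic solution, with frequency vector $\boldsymbol{\omega}$, of $\ddot x+\gamma\dot x+x^{2p+1}=f(\boldsymbol{\omega}t)$ which exists for $\gamma$ large enough and satisfies $x_0(t)=\alpha+O(1/\gamma)$, $\alpha=f_{\boldsymbol 0}^{1/(2p+1)}$. Consider the equation $$\ddot\xi+\gamma\dot\xi+\xi F(\xi,x_0(t))=0,\qquad F(\xi,x):=\frac{1}{\xi}\left((x+\xi)^{2p+1}-x^{2p+1}\right).$$ There exists $\gamma_1>0$ such that for all $\gamma>\gamma_1$ all trajectories in phase space, i.e. in the plane $(\xi,\dot\xi)$, converge toward the origin as time goes to infinity.
   Context: $p\in\mathbb{N}$; $\gamma>0$ is a real parameter. $f(\boldsymbol{\psi})=\sum_{\boldsymbol{\nu}\in\mathbb{Z}^d}e^{i\boldsymbol{\nu}\cdot\boldsymbol{\psi}}f_{\boldsymbol{\nu}}$ is real-valued and analytic (there are constants $\Phi,\kappa>0$ with $|f_{\boldsymbol{\nu}}|\le \Phi e^{-\kappa|\boldsymbol{\nu}|}$ for all $\boldsymbol{\nu}$), with non-zero average $f_{\boldsymbol 0}\ne0$. The vector $\boldsymbol{\omega}\in\mathbb{R}^d$ satisfies $|\boldsymbol{\omega}\cdot\boldsymbol{\nu}|\ge C_0|\boldsymbol{\nu}|^{-\tau}$ for all $\boldsymbol{\nu}\in\mathbb{Z}^d\setminus\{\boldsymbol 0\}$, with $|\boldsymbol{\nu}|=|\nu_1|+\dots+|\nu_d|$, $C_0>0$ small enough and $\tau>d-1$.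 There is $\gamma_0>0$ such that for all $\gamma>\gamma_0$ the equation $\ddot x+\gamma\dot x+x^{2p+1}=f(\boldsymbol{\omega}t)$ has a quasi-periodic solution $x_0(t)=X(\boldsymbol{\omega}t)$ ($X$ being $2\pi$-periodic in each argument), with $x_0(t)=\alpha+O(1/\gamma)$, which extends to a function analytic in $1/\gamma$ in a disc of the complex plane centered on the real axis and tangent to the imaginary axis at the origin. $F(\xi,x)$ is a polynomial in $(\xi,x)$, with $F(0,x)=(2p+1)x^{2p}$. *)

theory Defs
  imports "HOL-Analysis.Analysis"
begin

definition ivec_norm :: "int ^ 'n \<Rightarrow> real" where
  "ivec_norm \<nu> = (\<Sum>i\<in>UNIV. \<bar>real_of_int (\<nu> $ i)\<bar>)"

definition ivec_inner :: "int ^ 'n \<Rightarrow> real ^ 'n \<Rightarrow> real" where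
  "ivec_inner \<nu> \<psi> = (\<Sum>i\<in>UNIV. real_of_int (\<nu> $ i) * \<psi> $ i)"

(* c is the family of Fourier coefficients of f. It is determined by f, since the series
   converges uniformly; in particular c 0 is the average of f, and it is real. *)
definition analytic_forcing :: "(real ^ 'n \<Rightarrow> real) \<Rightarrow> (int ^ 'n \<Rightarrow> complex) \<Rightarrow> bool" where
  "analytic_forcing f c \<longleftrightarrow>
     (\<exists>\<Phi>>0. \<exists>\<kappa>>0. \<forall>\<nu>. norm (c \<nu>) \<le> \<Phi> * exp (- \<kappa> * ivec_norm \<nu>)) \<and>
     (\<forall>\<psi>. ((\<lambda>\<nu>. exp (\<i> * complex_of_real (ivec_inner \<nu> \<psi>)) * c \<nu>)
            has_sum complex_of_real (f \<psi>)) UNIV)"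

definition diophantine :: "real ^ 'n \<Rightarrow> real \<Rightarrow> real \<Rightarrow> bool" where
  "diophantine \<omega> C0 \<tau> \<longleftrightarrow>
     (\<forall>\<nu>. \<nu> \<noteq> 0 \<longrightarrow> \<bar>ivec_inner \<nu> \<omega>\<bar> \<ge> C0 * ivec_norm \<nu> powr (- \<tau>))"

(* Continuity of X is essential: for d \<ge> 2 and rationally independent \<omega> the line t \<mapsto> t \<omega> is injective
   modulo 2 pi, so without it every function of t would qualify. *)
definition quasi_periodic :: "real ^ 'n \<Rightarrow> (real \<Rightarrow> real) \<Rightarrow> bool" where
  "quasi_periodic \<omega> x \<longleftrightarrow>
     (\<exists>X. continuous_on UNIV X \<and>
          (\<forall>\<psi> i. X (\<psi> + axis i (2 * pi)) = X \<psi>) \<and>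
          (\<forall>t. x t = X (t *\<^sub>R \<omega>)))"

(* x'' + \<gamma> x' + x^(2p+1) = g(t) on the whole real line *)
definition forced_solution :: "nat \<Rightarrow> real \<Rightarrow> (real \<Rightarrow> real) \<Rightarrow> (real \<Rightarrow> real) \<Rightarrow> bool" where
  "forced_solution p \<gamma> g x \<longleftrightarrow>
     (\<exists>x' x''. \<forall>t. (x has_real_derivative x' t) (at t) \<and>
                   (x' has_real_derivative x'' t) (at t) \<and>
                   x'' t + \<gamma> * x' t + x t ^ (2 * p + 1) = g t)"

(* A family x0 (indexed by \<gamma> > \<gamma>0) extends analytically in 1/\<gamma>. A disc centred on the real axis
   and tangent to the imaginary axis at 0, on the side of positive 1/\<gamma>, is a ball of
   centre R > 0 and radius R. *)
definition extends_analytically :: "real \<Rightarrow> (real \<Rightarrow> real \<Rightarrow> real) \<Rightarrow> bool" where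
  "extends_analytically \<gamma>0 x0 \<longleftrightarrow>
     (\<exists>R>0. \<exists>Z :: real \<Rightarrow> complex \<Rightarrow> complex.
        (\<forall>t. Z t analytic_on ball (complex_of_real R) R) \<and>
        (\<forall>\<gamma>>\<gamma>0. complex_of_real (1 / \<gamma>) \<in> ball (complex_of_real R) R \<longrightarrow>
            (\<forall>t. Z t (complex_of_real (1 / \<gamma>)) = complex_of_real (x0 \<gamma> t))))"

(* The polynomial ((x + \<xi>)^(2p+1) - x^(2p+1)) / \<xi>; division by zero yields 0 in HOL, so its
   value at \<xi> = 0 has to be given explicitly. *)
definition F :: "nat \<Rightarrow> real \<Rightarrow> real \<Rightarrow> real" where
  "F p \<xi> x = (if \<xi> = 0 then real (2 * p + 1) * x ^ (2 * p)
              else 1 / \<xi> * ((x + \<xi>) ^ (2 * p + 1) - x ^ (2 * p + 1)))"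

(* Phase-space trajectory (\<xi>, \<eta>), \<eta> = \<xi>', of \<xi>'' + \<gamma> \<xi>' + \<xi> F(\<xi>, x(t)) = 0 on [s, \<infinity>) *)
definition trajectory ::
  "nat \<Rightarrow> real \<Rightarrow> (real \<Rightarrow> real) \<Rightarrow> real \<Rightarrow> (real \<Rightarrow> real) \<Rightarrow> (real \<Rightarrow> real) \<Rightarrow> bool" where
  "trajectory p \<gamma> x s \<xi> \<eta> \<longleftrightarrow>
     (\<exists>\<eta>'. \<forall>t\<ge>s. (\<xi> has_real_derivative \<eta> t) (at t within {s..}) \<and>
                 (\<eta> has_real_derivative \<eta>' t) (at t within {s..}) \<and>
                 \<eta>' t + \<gamma> * \<eta> t + \<xi> t * F p (\<xi> t) (x t) = 0)"

end

theory Submission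
  imports Defs "HOL-Real_Asymp.Real_Asymp"
begin

text \<open>
  Subtracting the forced solution \<open>x\<close> reduces the claim to a statement about the damped oscillator
  \<open>\<xi>'' + \<gamma> \<xi>' + g(x(t), \<xi>) = 0\<close> with \<open>g(x, \<xi>) = (x + \<xi>)^(2p+1) - x^(2p+1)\<close>.
  The restoring force is monotone in \<open>\<xi>\<close>, so for constant \<open>x\<close> the energy
  \<open>\<xi>'\<^sup>2 / 2 + H(x, \<xi>)\<close>, with \<open>H\<close> the primitive of \<open>g\<close> in \<open>\<xi>\<close>, decreases, but only as
  fast as \<open>\<gamma> \<xi>'\<^sup>2\<close>, which degenerates at the turning points. The cross term in
    \<open>V = (\<xi>' + \<gamma> \<xi> / 2)\<^sup>2 / 2 + \<gamma>\<^sup>2 \<xi>\<^sup>2 / 8 + H(x, \<xi>)\<close>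
  removes the degeneracy: along trajectories
    \<open>V' = - \<gamma> \<xi>'\<^sup>2 / 2 - \<gamma> \<xi> g / 2 + x' (\<partial>H / \<partial>x)\<close>,
  and convexity of \<open>u \<mapsto> u^(2p+2)\<close> gives \<open>0 \<le> H \<le> \<xi> g\<close>.

  The last term of \<open>V'\<close> is the price for \<open>x\<close> depending on time. Two facts make it harmless for large
  \<open>\<gamma>\<close>. As \<open>\<bar>x\<bar> \<ge> a > 0\<close>, both \<open>\<xi>\<^sup>2\<close> and \<open>\<bar>\<partial>H / \<partial>x\<bar>\<close> are at most a constant times
  \<open>\<xi> g\<close>, globally in \<open>\<xi>\<close> (\<open>restoring_work_lower\<close>, \<open>potential_dx_le_work\<close>).
  And \<open>x'\<close> is of order \<open>1 / \<gamma>\<close>, since a velocity above that size would have to have been growing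
  exponentially in the past, contradicting the boundedness of \<open>x\<close> (\<open>damped_velocity_bound\<close>).
  Hence \<open>V' \<le> - k V\<close> for some \<open>k > 0\<close>, so \<open>V\<close> and with it \<open>(\<xi>, \<xi>')\<close> decay exponentially.

  The lower bound \<open>a\<close> is \<open>\<bar>\<alpha>\<bar> / 2\<close>, so \<open>\<alpha> \<noteq> 0\<close> is needed. This follows from \<open>c 0 \<noteq> 0\<close> once
  \<open>c 0\<close> is known to be real, which holds because it is the time average of the real function
  \<open>t \<mapsto> f(t \<omega>)\<close> (\<open>forcing_average_real\<close>).

  Global existence of trajectories is obtained by cutting the force off at \<open>\<bar>\<xi>\<bar> = R\<close>, which makes it
  globally Lipschitz; \<open>V\<close> then keeps the solution of the modified equation below \<open>R\<close>, where the
  cut-off is not felt.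
\<close>

section \<open>The average of the forcing\<close>

lemma average_of_powers_tendsto_0:
  fixes z :: complex
  assumes "norm z = 1" "z \<noteq> 1"
  shows "(\<lambda>N. (\<Sum>k<N. z ^ k) / of_nat N) \<longlonglongrightarrow> 0"
proof (rule Lim_null_comparison)
  have "norm ((\<Sum>k<N. z ^ k) / of_nat N) \<le> (2 / norm (1 - z)) * (1 / real N)" for N
  proof -
    have "norm (1 - z ^ N) \<le> 2"
      using norm_triangle_ineq4[of 1 "z ^ N"] assms(1) by (simp add: norm_power)
    then show ?thesis
      using assms by (simp add: sum_gp_strict norm_divide divide_right_mono norm_mult)
  qed
  then show "\<forall>\<^sub>F N in sequentially. norm ((\<Sum>k<N. z ^ k) / of_nat N) \<le> (2 / norm (1 - z)) * (1 / real N)"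
    by simp
  show "(\<lambda>N. (2 / norm (1 - z)) * (1 / real N)) \<longlonglongrightarrow> 0"
    by (rule tendsto_mult_right_zero) (rule lim_1_over_n)
qed

text \<open>
  Averages over the discrete times \<open>k h\<close> can stand in for time integrals, and interchange with the
  Fourier series for free, provided that no non-zero frequency is aliased to zero. Each pair of a
  frequency and an integer excludes one \<open>h\<close>, hence only countably many are bad.
\<close>
lemma exists_nonresonant_step:
  fixes l :: "'a::countable \<Rightarrow> real"
  obtains h where "\<And>\<nu>. l \<nu> \<noteq> 0 \<Longrightarrow> exp (\<i> * of_real (l \<nu> * h)) \<noteq> 1"
proof -
  define B where "B = range (\<lambda>(\<nu>, n::int). of_int (2 * n) * pi / l \<nu>)"
  have "countable B" unfolding B_def by (intro countable_image) simp
  then obtain h where h: "h \<notin> B" using uncountable_UNIV_real by (metis UNIV_I countable_subset subsetI)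
  show thesis
  proof (rule that, rule notI)
    fix \<nu> assume l: "l \<nu> \<noteq> 0" and "exp (\<i> * of_real (l \<nu> * h)) = 1"
    then obtain n :: int where "l \<nu> * h = of_int (2 * n) * pi" by (auto simp: exp_eq_1)
    then have "h = of_int (2 * n) * pi / l \<nu>" using l by (simp add: field_simps)
    then show False using h unfolding B_def by (auto intro: image_eqI[of _ _ "(\<nu>, n)"])
  qed
qed

text \<open>
  The dominated convergence theorem for the counting measure.
\<close>
lemma infsum_dominated_convergence:
  fixes g :: "nat \<Rightarrow> 'a \<Rightarrow> 'b::{banach, second_countable_topology}"
  assumes "\<And>\<nu>. (\<lambda>N. g N \<nu>) \<longlonglongrightarrow> g' \<nu>" and "\<And>N \<nu>. norm (g N \<nu>) \<le> b \<nu>"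
    and "b summable_on UNIV"
  shows "(\<lambda>N. infsum (g N) UNIV) \<longlonglongrightarrow> infsum g' UNIV"
proof -
  have b0: "0 \<le> b \<nu>" for \<nu> using assms(2)[of 0 \<nu>] norm_ge_zero order_trans by blast
  have bs: "(\<lambda>\<nu>. norm (b \<nu>)) summable_on UNIV" using assms(3) b0 by simp
  have b: "Infinite_Set_Sum.abs_summable_on b UNIV"
    using bs by (simp only: abs_summable_equivalent)
  have g'b: "norm (g' \<nu>) \<le> b \<nu>" for \<nu>
    using assms(1)[of \<nu>] assms(2) by (intro Lim_norm_ubound) auto
  have g: "Infinite_Set_Sum.abs_summable_on (g N) UNIV" for N by (rule abs_summable_on_comparison_test'[OF b assms(2)])
  have g': "Infinite_Set_Sum.abs_summable_on g' UNIV" by (rule abs_summable_on_comparison_test'[OF b g'b])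
  have "(\<lambda>N. infsetsum (g N) UNIV) \<longlonglongrightarrow> infsetsum g' UNIV"
    unfolding infsetsum_def
  proof (rule integral_dominated_convergence[where w = b])
    show "integrable (count_space UNIV) b" using b by (simp add: Infinite_Set_Sum.abs_summable_on_def)
    show "AE \<nu> in count_space UNIV. (\<lambda>N. g N \<nu>) \<longlonglongrightarrow> g' \<nu>"
      by (intro AE_I2 assms(1))
    show "AE \<nu> in count_space UNIV. norm (g N \<nu>) \<le> b \<nu>" for N
      by (intro AE_I2 assms(2))
  qed simp_all
  then show ?thesis by (simp only: infsetsum_infsum[OF g] infsetsum_infsum[OF g'])
qed

text \<open>
  In the average of \<open>g\<close> over \<open>0, h, \<dots>, (N-1) h\<close> the mode \<open>\<nu>\<close> is multiplied by a normalised geometric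
  sum. This factor is 1 for the zero mode and tends to 0 for all others, so the averages, which are
  real, converge to \<open>c z\<close>.
\<close>
lemma zero_mode_real:
  fixes c :: "'a::countable \<Rightarrow> complex" and l :: "'a \<Rightarrow> real" and g :: "real \<Rightarrow> real"
  assumes g: "\<And>t. ((\<lambda>\<nu>. exp (\<i> * of_real (l \<nu> * t)) * c \<nu>) has_sum of_real (g t)) UNIV"
    and l: "\<And>\<nu>. l \<nu> = 0 \<longleftrightarrow> \<nu> = z"
  shows "c z \<in> \<real>"
proof -
  obtain h where h: "\<And>\<nu>. l \<nu> \<noteq> 0 \<Longrightarrow> exp (\<i> * of_real (l \<nu> * h)) \<noteq> 1"
    using exists_nonresonant_step[of l] by metis
  define e where "e \<nu> = exp (\<i> * of_real (l \<nu> * h))" for \<nu>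
  define A where "A N \<nu> = (\<Sum>k<N. e \<nu> ^ k) / of_nat N" for N \<nu>
  have ne: "norm (e \<nu>) = 1" for \<nu> by (simp add: e_def)
  have "c summable_on UNIV" using g[of 0] by (auto simp: summable_on_def)
  then have cs: "(\<lambda>\<nu>. norm (c \<nu>)) summable_on UNIV"
    by (simp add: summable_on_iff_abs_summable_on_complex)
  have "norm (A N \<nu>) \<le> 1" for N \<nu>
  proof -
    have "norm (\<Sum>k<N. e \<nu> ^ k) \<le> (\<Sum>k<N. 1)"
      by (rule sum_norm_le) (simp add: norm_power ne)
    then show ?thesis by (simp add: A_def norm_divide divide_le_eq)
  qed
  then have dom: "norm (A N \<nu> * c \<nu>) \<le> norm (c \<nu>)" for N \<nu>
    by (simp add: norm_mult mult_left_le_one_le)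
  have lim: "(\<lambda>N. A N \<nu> * c \<nu>) \<longlonglongrightarrow> (if \<nu> = z then c z else 0)" for \<nu>
  proof (cases "\<nu> = z")
    case True
    have "\<forall>\<^sub>F N in sequentially. c z = A N \<nu> * c \<nu>"
      by (rule eventually_mono[OF eventually_gt_at_top[of 0]]) (use l[of z] in \<open>simp add: A_def e_def True\<close>)
    then show ?thesis using True by (auto intro: Lim_transform_eventually[OF tendsto_const])
  next
    case False
    then have "e \<nu> \<noteq> 1" using h l by (simp add: e_def)
    from tendsto_mult_left_zero[OF average_of_powers_tendsto_0[OF ne this]]
    show ?thesis using False by (simp add: A_def)
  qed
  have sum: "((\<lambda>\<nu>. A N \<nu> * c \<nu>) has_sum of_real ((\<Sum>k<N. g (real k * h)) / real N)) UNIV" for N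
  proof -
    have "e \<nu> ^ k = exp (\<i> * of_real (l \<nu> * (real k * h)))" for \<nu> k
      by (simp add: e_def flip: exp_of_nat_mult) (simp add: mult_ac)
    then have "((\<lambda>\<nu>. e \<nu> ^ k * c \<nu>) has_sum of_real (g (real k * h))) UNIV" for k
      using g[of "real k * h"] by simp
    then have "((\<lambda>\<nu>. \<Sum>k<N. e \<nu> ^ k * c \<nu>) has_sum (\<Sum>k<N. of_real (g (real k * h)))) UNIV"
      by (induction N) (simp_all add: has_sum_0 has_sum_add)
    from has_sum_cmult_right[OF this, of "1 / of_nat N"] show ?thesis
      by (simp add: A_def sum_distrib_right)
  qed
  have "(\<lambda>N. infsum (\<lambda>\<nu>. A N \<nu> * c \<nu>) UNIV) \<longlonglongrightarrow> infsum (\<lambda>\<nu>. if \<nu> = z then c z else 0) UNIV"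
    by (rule infsum_dominated_convergence[OF lim dom cs])
  moreover have "infsum (\<lambda>\<nu>. if \<nu> = z then c z else 0) UNIV = infsum (\<lambda>\<nu>. c z) {z}"
    by (rule infsum_cong_neutral) auto
  ultimately have "(\<lambda>N. of_real ((\<Sum>k<N. g (real k * h)) / real N)) \<longlonglongrightarrow> c z"
    by (simp add: infsumI[OF sum])
  then show ?thesis
    by (rule Lim_in_closed_set[OF closed_complex_Reals, rotated 2]) auto
qed

lemma analytic_forcing_bounded:
  assumes "analytic_forcing f c"
  obtains B where "\<And>\<psi>. \<bar>f \<psi>\<bar> \<le> B"
proof
  fix \<psi>
  let ?e = "\<lambda>\<nu>. exp (\<i> * complex_of_real (ivec_inner \<nu> \<psi>)) * c \<nu>"
  have s: "(?e has_sum complex_of_real (f \<psi>)) UNIV"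
    using assms by (simp add: analytic_forcing_def)
  then have "?e summable_on UNIV"
    by (rule has_sum_imp_summable)
  then have "(\<lambda>\<nu>. norm (?e \<nu>)) summable_on UNIV"
    by (simp only: summable_on_iff_abs_summable_on_complex)
  from norm_infsum_bound[OF this] show "\<bar>f \<psi>\<bar> \<le> (\<Sum>\<^sub>\<infinity>\<nu>. norm (c \<nu>))"
    using infsumI[OF s] by (simp add: norm_mult)
qed

lemma ivec_inner_scaleR: "ivec_inner \<nu> (t *\<^sub>R \<omega>) = ivec_inner \<nu> \<omega> * t"
  by (simp add: ivec_inner_def sum_distrib_left mult_ac)

lemma ivec_norm_pos: "\<nu> \<noteq> 0 \<Longrightarrow> 0 < ivec_norm \<nu>"
proof -
  assume "\<nu> \<noteq> 0"
  then obtain i where "\<nu> $ i \<noteq> 0" by (auto simp: vec_eq_iff)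
  then show ?thesis unfolding ivec_norm_def by (intro sum_pos2[of _ i]) auto
qed

text \<open>
  The Diophantine condition makes \<open>\<omega>\<close> rationally independent, so that time averages along the line
  \<open>t \<omega>\<close> isolate the coefficient of index 0.
\<close>
lemma forcing_average_real:
  fixes f :: "real ^ 'n \<Rightarrow> real" and \<omega> :: "real ^ 'n"
  assumes "analytic_forcing f c" "diophantine \<omega> C0 \<tau>" "C0 > 0"
  shows "c 0 \<in> \<real>"
proof (rule zero_mode_real[of "\<lambda>\<nu>. ivec_inner \<nu> \<omega>" c "\<lambda>t. f (t *\<^sub>R \<omega>)"])
  show "((\<lambda>\<nu>. exp (\<i> * of_real (ivec_inner \<nu> \<omega> * t)) * c \<nu>) has_sum of_real (f (t *\<^sub>R \<omega>))) UNIV" for t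
    using assms(1) unfolding analytic_forcing_def ivec_inner_scaleR[symmetric] by blast
  show "ivec_inner \<nu> \<omega> = 0 \<longleftrightarrow> \<nu> = 0" for \<nu>
  proof
    assume 0: "ivec_inner \<nu> \<omega> = 0"
    show "\<nu> = 0"
    proof (rule ccontr)
      assume \<nu>: "\<nu> \<noteq> 0"
      then have "C0 * ivec_norm \<nu> powr (- \<tau>) \<le> 0" using assms(2) 0 unfolding diophantine_def by (metis abs_zero)
      moreover have "0 < C0 * ivec_norm \<nu> powr (- \<tau>)" using ivec_norm_pos[OF \<nu>] assms(3) by simp
      ultimately show False by linarith
    qed
  qed (simp add: ivec_inner_def)
qed

section \<open>The velocity of bounded solutions\<close>

text \<open>
  If \<open>v = x'\<close> exceeded \<open>M / \<gamma>\<close> at time \<open>t\<close> by \<open>\<delta>\<close>, then, as \<open>exp (\<gamma> r) (v - M / \<gamma>)\<close> is nonincreasing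
  in \<open>r\<close>, the excess would have been at least \<open>\<delta>\<close> at all earlier times, and \<open>x\<close> would be unbounded
  in the past.
\<close>
lemma damped_velocity_bound_above:
  fixes x v h :: "real \<Rightarrow> real"
  assumes \<gamma>: "\<gamma> > 0" and x: "\<And>t. (x has_real_derivative v t) (at t)"
    and v: "\<And>t. (v has_real_derivative h t - \<gamma> * v t) (at t)"
    and h: "\<And>t. h t \<le> M" and M: "0 \<le> M" and xb: "\<And>t. \<bar>x t\<bar> \<le> K"
  shows "v t \<le> M / \<gamma>"
proof (rule ccontr)
  assume "\<not> v t \<le> M / \<gamma>"
  define \<delta> where "\<delta> = v t - M / \<gamma>"
  have \<delta>: "\<delta> > 0" using \<open>\<not> v t \<le> M / \<gamma>\<close> by (simp add: \<delta>_def)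
  have low: "M / \<gamma> + \<delta> \<le> v r" if "r \<le> t" for r
  proof -
    have "exp (\<gamma> * t) * (v t - M / \<gamma>) \<le> exp (\<gamma> * r) * (v r - M / \<gamma>)"
    proof (rule DERIV_nonpos_imp_nonincreasing[OF that], intro exI conjI)
      fix u
      show "((\<lambda>u. exp (\<gamma> * u) * (v u - M / \<gamma>)) has_real_derivative exp (\<gamma> * u) * (h u - M)) (at u)"
        using v[of u] \<gamma> by (auto intro!: derivative_eq_intros simp: field_simps)
      show "exp (\<gamma> * u) * (h u - M) \<le> 0" using h[of u] by (simp add: mult_nonneg_nonpos)
    qed
    also have "\<dots> = exp (\<gamma> * t) * (exp (\<gamma> * (r - t)) * (v r - M / \<gamma>))"
      by (simp add: algebra_simps flip: exp_add)
    finally have *: "\<delta> \<le> exp (\<gamma> * (r - t)) * (v r - M / \<gamma>)" by (simp add: \<delta>_def)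
    then have "0 < exp (\<gamma> * (r - t)) * (v r - M / \<gamma>)" using \<delta> by linarith
    then have "0 \<le> v r - M / \<gamma>" by (simp add: zero_less_mult_iff)
    moreover have "exp (\<gamma> * (r - t)) \<le> 1" using that \<gamma> by (simp add: mult_nonneg_nonpos)
    ultimately have "exp (\<gamma> * (r - t)) * (v r - M / \<gamma>) \<le> v r - M / \<gamma>"
      by (intro mult_left_le_one_le) auto
    then show ?thesis using * by linarith
  qed
  have K: "K \<ge> 0" using xb[of 0] by linarith
  \<comment> \<open>Over a time span of this length \<open>x\<close> would increase by more than \<open>2 K\<close>.\<close>
  define r where "r = t - (2 * K + 1) / \<delta>"
  have r: "r < t" using K \<delta> by (simp add: r_def divide_pos_pos)
  obtain u where u: "u < t" "x t - x r = (t - r) * v u"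
    using MVT2[OF r, of x v] x by blast
  have "0 \<le> M / \<gamma>" using M \<gamma> by simp
  then have "\<delta> \<le> v u" using low[of u] u(1) by linarith
  then have "(t - r) * \<delta> \<le> x t - x r" using u(2) r by simp
  then have "2 * K + 1 \<le> x t - x r" using \<delta> by (simp add: r_def)
  then show False using xb[of t] xb[of r] by linarith
qed

lemma damped_velocity_bound:
  fixes x v h :: "real \<Rightarrow> real"
  assumes \<gamma>: "\<gamma> > 0" and x: "\<And>t. (x has_real_derivative v t) (at t)"
    and v: "\<And>t. (v has_real_derivative h t - \<gamma> * v t) (at t)"
    and h: "\<And>t. \<bar>h t\<bar> \<le> M" and xb: "\<And>t. \<bar>x t\<bar> \<le> K"
  shows "\<bar>v t\<bar> \<le> M / \<gamma>"
proof -
  have M: "0 \<le> M" using h[of 0] by linarith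
  have "v t \<le> M / \<gamma>"
    by (rule damped_velocity_bound_above[OF \<gamma> x v _ M xb]) (use h abs_le_D1 in blast)
  moreover have "- v t \<le> M / \<gamma>"
  proof (rule damped_velocity_bound_above[OF \<gamma>, of "\<lambda>t. - x t" "\<lambda>t. - v t" "\<lambda>t. - h t"])
    show "((\<lambda>t. - v t) has_real_derivative - h t - \<gamma> * - v t) (at t)" for t
      using DERIV_minus[OF v[of t]] by (simp add: algebra_simps)
    show "- h t \<le> M" for t using h abs_le_D2 by blast
  qed (use xb M x in \<open>auto intro!: DERIV_minus\<close>)
  ultimately show ?thesis by linarith
qed

section \<open>The restoring force and its potential\<close>

text \<open>
  The difference of the two sides is \<open>(u\<^sup>2 - x\<^sup>2) ((u\<^sup>2)^p - (x\<^sup>2)^p)\<close>, a product of two factors of the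
  same sign.
\<close>
lemma odd_power_monotone:
  fixes u x :: real
  shows "(u ^ (2*p) + x ^ (2*p)) * (u - x)\<^sup>2 \<le> 2 * ((u - x) * (u ^ (2*p+1) - x ^ (2*p+1)))"
proof -
  have "0 \<le> (u\<^sup>2 - x\<^sup>2) * ((u\<^sup>2)^p - (x\<^sup>2)^p)"
  proof (cases "u\<^sup>2 \<le> x\<^sup>2")
    case True
    then have "(u\<^sup>2)^p \<le> (x\<^sup>2)^p" using True by (intro power_mono[of "u\<^sup>2"]) simp_all
    then show ?thesis using True by (intro mult_nonpos_nonpos) auto
  next
    case False
    then have "(x\<^sup>2)^p \<le> (u\<^sup>2)^p" using False by (intro power_mono[of "x\<^sup>2"]) simp_all
    then show ?thesis using False by (intro mult_nonneg_nonneg) auto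
  qed
  moreover have "2 * ((u - x) * (u ^ (2*p+1) - x ^ (2*p+1))) - (u ^ (2*p) + x ^ (2*p)) * (u - x)\<^sup>2
      = (u\<^sup>2 - x\<^sup>2) * ((u\<^sup>2)^p - (x\<^sup>2)^p)"
    by (simp add: power_mult power2_eq_square algebra_simps)
  ultimately show ?thesis by linarith
qed

text \<open>
  The remainders \<open>R n\<close> satisfy \<open>R (n+1) = u R n + n x^(n-1) (u - x)\<^sup>2\<close>. The factor \<open>r\<close> on the left
  avoids the exponent \<open>n - 2\<close>, which would be truncated at \<open>n = 1\<close>.
\<close>
lemma power_taylor_remainder:
  fixes u x :: real
  assumes "n \<ge> 1" and u: "\<bar>u\<bar> \<le> r" and x: "\<bar>x\<bar> \<le> r"
  shows "r * \<bar>u ^ n - x ^ n - real n * x ^ (n - 1) * (u - x)\<bar> \<le> (real n)\<^sup>2 * r ^ (n - 1) * (u - x)\<^sup>2"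
  using \<open>n \<ge> 1\<close>
proof (induction n rule: nat_induct_at_least)
  case base
  have "r \<ge> 0" using u by linarith
  then show ?case by simp
next
  case (Suc n)
  define R where "R = u ^ n - x ^ n - real n * x ^ (n - 1) * (u - x)"
  have r: "r \<ge> 0" using u by linarith
  have n: "x ^ n = x * x ^ (n - 1)" "r ^ n = r * r ^ (n - 1)"
    using Suc by (auto simp flip: power_Suc)
  have "u ^ Suc n - x ^ Suc n - real (Suc n) * x ^ n * (u - x)
      = u * R + real n * x ^ (n - 1) * (u - x)\<^sup>2"
    unfolding R_def by (simp add: n(1) power2_eq_square algebra_simps)
  also have "\<bar>\<dots>\<bar> \<le> \<bar>u\<bar> * \<bar>R\<bar> + real n * \<bar>x\<bar> ^ (n - 1) * (u - x)\<^sup>2"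
    by (rule order_trans[OF abs_triangle_ineq]) (simp add: abs_mult power_abs)
  also have "\<dots> \<le> r * \<bar>R\<bar> + real n * r ^ (n - 1) * (u - x)\<^sup>2"
    using u x r by (intro add_mono mult_right_mono mult_left_mono power_mono[OF x]) auto
  also have "\<dots> \<le> (real n)\<^sup>2 * r ^ (n - 1) * (u - x)\<^sup>2 + real n * r ^ (n - 1) * (u - x)\<^sup>2"
    using Suc.IH by (simp add: R_def)
  also have "\<dots> = ((real n)\<^sup>2 + real n) * (r ^ (n - 1) * (u - x)\<^sup>2)"
    by (simp add: algebra_simps)
  also have "\<dots> \<le> (real (Suc n))\<^sup>2 * (r ^ (n - 1) * (u - x)\<^sup>2)"
    using r by (rule_tac mult_right_mono) (simp_all add: power2_eq_square[of "real n"] power2_eq_square[of "1 + real n"] algebra_simps)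
  finally have "r * \<bar>u ^ Suc n - x ^ Suc n - real (Suc n) * x ^ n * (u - x)\<bar>
      \<le> r * ((real (Suc n))\<^sup>2 * (r ^ (n - 1) * (u - x)\<^sup>2))"
    using r by (intro mult_left_mono) auto
  then show ?case by (simp only: diff_Suc_1 n(2) mult_ac)
qed

lemma even_power_above_tangent:
  fixes u x :: real
  shows "x ^ (2*p+2) + real (2*p+2) * x ^ (2*p+1) * (u - x) \<le> u ^ (2*p+2)"
proof -
  have "real (2*p+2) * x ^ (2*p+1) * (u - x) \<le> u ^ (2*p+2) - x ^ (2*p+2)"
  proof (rule convex_on_imp_above_tangent[where A = UNIV])
    show "convex_on UNIV (\<lambda>x::real. x ^ (2*p+2))" by (rule convex_power_even) simp
    show "((\<lambda>x. x ^ (2*p+2)) has_field_derivative real (2*p+2) * x ^ (2*p+1)) (at x within UNIV)"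
      using DERIV_pow[of "2*p+2" x UNIV] by simp
  qed auto
  then show ?thesis by linarith
qed

definition restoring :: "nat \<Rightarrow> real \<Rightarrow> real \<Rightarrow> real" where
  "restoring p x \<xi> = (x + \<xi>) ^ (2*p+1) - x ^ (2*p+1)"

text \<open>
  The primitive in \<open>\<xi>\<close> of \<open>restoring p x \<xi>\<close> that vanishes at \<open>\<xi> = 0\<close>.
\<close>
definition potential :: "nat \<Rightarrow> real \<Rightarrow> real \<Rightarrow> real" where
  "potential p x \<xi> = ((x + \<xi>) ^ (2*p+2) - x ^ (2*p+2)) / real (2*p+2) - x ^ (2*p+1) * \<xi>"

text \<open>
  The derivative of \<open>potential p x \<xi>\<close> with respect to \<open>x\<close>.
\<close>
definition potential_dx :: "nat \<Rightarrow> real \<Rightarrow> real \<Rightarrow> real" where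
  "potential_dx p x \<xi> = (x + \<xi>) ^ (2*p+1) - x ^ (2*p+1) - real (2*p+1) * x ^ (2*p) * \<xi>"

lemma restoring_eq: "\<xi> * F p \<xi> x = restoring p x \<xi>"
  by (simp add: F_def restoring_def)

text \<open>
  With \<open>x\<close> bounded away from 0 the linear part of the force is non-degenerate, and this survives
  for all displacements.
\<close>
lemma restoring_work_lower: "x ^ (2*p) / 2 * \<xi>\<^sup>2 \<le> \<xi> * restoring p x \<xi>"
proof -
  have "0 \<le> (x + \<xi>) ^ (2*p) * \<xi>\<^sup>2" by (simp add: power_mult)
  then show ?thesis
    using odd_power_monotone[of "x + \<xi>" p x] by (simp add: restoring_def algebra_simps)
qed

lemma potential_nonneg: "0 \<le> potential p x \<xi>"
  using even_power_above_tangent[of x p "x + \<xi>"]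
  by (simp add: potential_def field_simps)

text \<open>
  The potential is convex in \<open>\<xi>\<close>, and so lies below the value at 0 plus slope times displacement.
\<close>
lemma potential_le_work: "potential p x \<xi> \<le> \<xi> * restoring p x \<xi>"
proof -
  have "(x + \<xi>) ^ (2*p+2) - x ^ (2*p+2) \<le> real (2*p+2) * ((x + \<xi>) ^ (2*p+1) * \<xi>)"
    using even_power_above_tangent[of "x + \<xi>" p x] by (simp add: algebra_simps)
  then have "((x + \<xi>) ^ (2*p+2) - x ^ (2*p+2)) / real (2*p+2) \<le> (x + \<xi>) ^ (2*p+1) * \<xi>"
    by (subst pos_divide_le_eq) (auto simp: mult_ac)
  then show ?thesis
    by (simp add: potential_def restoring_def algebra_simps)
qed

text \<open>
  Near \<open>\<xi> = 0\<close> both sides are quadratic in \<open>\<xi>\<close>; at infinity the left side grows at most like \<open>\<xi>^(2p+1)\<close> and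
  the right side like \<open>\<xi>^(2p+2)\<close>. Therefore one constant works for all \<open>\<xi>\<close>, and the drift of \<open>x\<close> can be
  controlled for arbitrarily large initial data.
\<close>
lemma potential_dx_le_work:
  assumes a: "0 < a" "a \<le> \<bar>x\<bar>"
  shows "a * \<bar>potential_dx p x \<xi>\<bar> \<le> 2 * (real (2*p+1))\<^sup>2 * (\<xi> * restoring p x \<xi>)"
proof -
  define u where "u = x + \<xi>"
  define r where "r = max \<bar>u\<bar> \<bar>x\<bar>"
  have r: "a \<le> r" "\<bar>u\<bar> \<le> r" "\<bar>x\<bar> \<le> r" using a by (auto simp: r_def)
  have "r ^ (2*p) \<le> \<bar>u\<bar> ^ (2*p) + \<bar>x\<bar> ^ (2*p)"
    by (auto simp: r_def max_def)
  then have rp: "r ^ (2*p) \<le> u ^ (2*p) + x ^ (2*p)"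
    by (simp add: power_even_abs)
  have "a * \<bar>potential_dx p x \<xi>\<bar> \<le> r * \<bar>potential_dx p x \<xi>\<bar>"
    using r(1) by (intro mult_right_mono) auto
  also have "\<dots> \<le> (real (2*p+1))\<^sup>2 * r ^ (2*p) * (u - x)\<^sup>2"
    using power_taylor_remainder[of "2*p+1" u r x] r by (simp add: potential_dx_def u_def)
  also have "\<dots> = (real (2*p+1))\<^sup>2 * (r ^ (2*p) * (u - x)\<^sup>2)"
    by (simp only: mult_ac)
  also have "\<dots> \<le> (real (2*p+1))\<^sup>2 * ((u ^ (2*p) + x ^ (2*p)) * (u - x)\<^sup>2)"
    using rp by (intro mult_left_mono mult_right_mono) auto
  also have "\<dots> \<le> (real (2*p+1))\<^sup>2 * (2 * ((u - x) * (u ^ (2*p+1) - x ^ (2*p+1))))"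
    by (intro mult_left_mono odd_power_monotone) auto
  finally show ?thesis by (simp add: u_def restoring_def mult.left_commute[of _ 2])
qed

lemma restoring_lipschitz:
  assumes x: "\<bar>x\<bar> \<le> K" and u: "\<bar>u\<bar> \<le> R" and v: "\<bar>v\<bar> \<le> R"
  shows "\<bar>restoring p x u - restoring p x v\<bar> \<le> real (2*p+1) * (K + R) ^ (2*p) * \<bar>u - v\<bar>"
proof -
  define q where "q = K + R"
  have "norm ((x + u) ^ (2*p+1) - (x + v) ^ (2*p+1)) \<le> real (2*p+1) * q ^ (2*p) * norm ((x + u) - (x + v))"
  proof (rule field_differentiable_bound[of "{-q..q}"])
    fix z assume "z \<in> {-q..q}"
    then have "\<bar>z\<bar> \<le> q" by auto
    then have "\<bar>z\<bar> ^ (2*p) \<le> q ^ (2*p)" by (intro power_mono) auto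
    then show "norm (real (2*p+1) * z ^ (2*p)) \<le> real (2*p+1) * q ^ (2*p)"
      unfolding norm_mult by (intro mult_mono) (auto simp: power_abs)
    show "((\<lambda>z. z ^ (2*p+1)) has_real_derivative real (2*p+1) * z ^ (2*p)) (at z within {-q..q})"
      using DERIV_pow[of "2*p+1" z "{-q..q}"] by simp
  qed (use x u v in \<open>auto simp: q_def\<close>)
  then show ?thesis by (simp add: restoring_def q_def)
qed

section \<open>The Lyapunov function\<close>

text \<open>
  Energy \<open>\<eta>\<^sup>2 / 2 + H\<close> plus \<open>(\<gamma> / 2) (\<xi> \<eta> + \<gamma> \<xi>\<^sup>2 / 2)\<close>, with squares completed. The added term has
  derivative \<open>(\<gamma> / 2) (\<eta>\<^sup>2 - \<xi> g)\<close>: it trades half of the damping of the velocity for a damping of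
  the position. It is essential that \<open>H\<close> is evaluated at the moving \<open>x\<close> and not at its mean \<open>\<alpha>\<close>,
  since the power \<open>\<eta> (g(x, \<xi>) - g(\<alpha>, \<xi>))\<close> is not controlled by the dissipation for large \<open>\<xi>\<close> when
  \<open>p > 1\<close>.
\<close>
definition lyapunov :: "nat \<Rightarrow> real \<Rightarrow> real \<Rightarrow> real \<Rightarrow> real \<Rightarrow> real" where
  "lyapunov p \<gamma> x \<xi> \<eta> = (\<eta> + \<gamma> / 2 * \<xi>)\<^sup>2 / 2 + \<gamma>\<^sup>2 / 8 * \<xi>\<^sup>2 + potential p x \<xi>"

lemma lyapunov_has_derivative:
  assumes "(x has_real_derivative x') (at t within S)"
    and "(\<xi> has_real_derivative \<eta> t) (at t within S)"
    and "(\<eta> has_real_derivative \<eta>') (at t within S)"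
    and "\<eta>' = - \<gamma> * \<eta> t - restoring p (x t) (\<xi> t)"
  shows "((\<lambda>t. lyapunov p \<gamma> (x t) (\<xi> t) (\<eta> t)) has_real_derivative
           - (\<gamma> / 2) * (\<eta> t)\<^sup>2 - \<gamma> / 2 * (\<xi> t * restoring p (x t) (\<xi> t))
           + x' * potential_dx p (x t) (\<xi> t)) (at t within S)"
proof -
  have "((\<lambda>t. (\<eta> t + \<gamma> / 2 * \<xi> t)\<^sup>2 / 2 + \<gamma>\<^sup>2 / 8 * (\<xi> t)\<^sup>2) has_real_derivative
      (\<eta> t + \<gamma> / 2 * \<xi> t) * (\<eta>' + \<gamma> / 2 * \<eta> t) + \<gamma>\<^sup>2 / 4 * \<xi> t * \<eta> t) (at t within S)"
    using assms(2,3) by (auto intro!: derivative_eq_intros simp: field_simps power2_eq_square)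
  moreover have "((\<lambda>t. (x t + \<xi> t) ^ (2*p+2) - x t ^ (2*p+2)) has_real_derivative
      real (2*p+2) * ((x t + \<xi> t) ^ (2*p+1) * (x' + \<eta> t) - x t ^ (2*p+1) * x')) (at t within S)"
    by (rule DERIV_cong[OF DERIV_diff[OF DERIV_power[OF DERIV_add[OF assms(1,2)]] DERIV_power[OF assms(1)]]])
      (simp add: algebra_simps)
  from DERIV_cdivide[OF this, of "real (2*p+2)"]
  have "((\<lambda>t. ((x t + \<xi> t) ^ (2*p+2) - x t ^ (2*p+2)) / real (2*p+2)) has_real_derivative
      (x t + \<xi> t) ^ (2*p+1) * (x' + \<eta> t) - x t ^ (2*p+1) * x') (at t within S)"
    by (simp del: of_nat_add of_nat_mult)
  moreover have "((\<lambda>t. x t ^ (2*p+1) * \<xi> t) has_real_derivative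
      real (2*p+1) * x t ^ (2*p) * x' * \<xi> t + x t ^ (2*p+1) * \<eta> t) (at t within S)"
    by (rule DERIV_cong[OF DERIV_mult[OF DERIV_power[OF assms(1)] assms(2)]]) (simp add: algebra_simps)
  ultimately have "((\<lambda>t. lyapunov p \<gamma> (x t) (\<xi> t) (\<eta> t)) has_real_derivative
      (\<eta> t + \<gamma> / 2 * \<xi> t) * (\<eta>' + \<gamma> / 2 * \<eta> t) + \<gamma>\<^sup>2 / 4 * \<xi> t * \<eta> t
      + (((x t + \<xi> t) ^ (2*p+1) * (x' + \<eta> t) - x t ^ (2*p+1) * x')
      - (real (2*p+1) * x t ^ (2*p) * x' * \<xi> t + x t ^ (2*p+1) * \<eta> t))) (at t within S)"
    unfolding lyapunov_def potential_def by (rule DERIV_add[OF _ DERIV_diff])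
  moreover have "(\<eta> t + \<gamma> / 2 * \<xi> t) * (\<eta>' + \<gamma> / 2 * \<eta> t) + \<gamma>\<^sup>2 / 4 * \<xi> t * \<eta> t
      + (((x t + \<xi> t) ^ (2*p+1) * (x' + \<eta> t) - x t ^ (2*p+1) * x')
      - (real (2*p+1) * x t ^ (2*p) * x' * \<xi> t + x t ^ (2*p+1) * \<eta> t))
    = - (\<gamma> / 2) * (\<eta> t)\<^sup>2 - \<gamma> / 2 * (\<xi> t * restoring p (x t) (\<xi> t)) + x' * potential_dx p (x t) (\<xi> t)"
    unfolding assms(4) restoring_def potential_dx_def by (simp add: field_simps power2_eq_square)
  ultimately show ?thesis by simp
qed

text \<open>
  Half of the dissipation \<open>(\<gamma> / 2) \<xi> g\<close> absorbs the drift term; the rest, together with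
  \<open>(\<gamma> / 2) \<eta>\<^sup>2\<close>, dominates a multiple of the Lyapunov function, each of whose terms is bounded by
  \<open>\<eta>\<^sup>2\<close> and \<open>\<xi> g\<close>.
\<close>
lemma lyapunov_decay_rate:
  assumes a: "0 < a" "a \<le> \<bar>x\<bar>" and \<gamma>: "0 < \<gamma>"
    and x': "8 * (real (2*p+1))\<^sup>2 * \<bar>x'\<bar> \<le> a * \<gamma>"
    and k: "0 \<le> k" "k \<le> \<gamma> / 2" "k * (3 * \<gamma>\<^sup>2 / 4 / a ^ (2*p) + 1) \<le> \<gamma> / 4"
  shows "- (\<gamma> / 2) * \<eta>\<^sup>2 - \<gamma> / 2 * (\<xi> * restoring p x \<xi>) + x' * potential_dx p x \<xi>
           \<le> - k * lyapunov p \<gamma> x \<xi> \<eta>"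
proof -
  define w where "w = \<xi> * restoring p x \<xi>"
  define n where "n = (real (2*p+1))\<^sup>2"
  have w0: "0 \<le> w" using potential_nonneg[of p x \<xi>] potential_le_work[of p x \<xi>] by (simp add: w_def)
  have "a ^ (2*p) \<le> \<bar>x\<bar> ^ (2*p)" using a by (intro power_mono) auto
  then have "a ^ (2*p) * \<xi>\<^sup>2 \<le> x ^ (2*p) * \<xi>\<^sup>2" by (intro mult_right_mono) (auto simp: power_even_abs)
  also have "\<dots> \<le> 2 * w" using restoring_work_lower[of x p \<xi>] by (simp add: w_def)
  finally have xi: "\<xi>\<^sup>2 \<le> 2 * w / a ^ (2*p)" using a by (simp add: field_simps)
  have "a * (x' * potential_dx p x \<xi>) \<le> \<bar>x'\<bar> * (a * \<bar>potential_dx p x \<xi>\<bar>)"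
    using a abs_ge_self[of "x' * potential_dx p x \<xi>"] by (simp add: abs_mult)
  also have "\<dots> \<le> \<bar>x'\<bar> * (2 * n * w)"
    using potential_dx_le_work[OF a, of p \<xi>] by (intro mult_left_mono) (auto simp: w_def n_def)
  also have "\<dots> = (8 * n * \<bar>x'\<bar>) * (w / 4)" by simp
  also have "\<dots> \<le> (a * \<gamma>) * (w / 4)" using x' w0 by (intro mult_right_mono) (auto simp: n_def)
  finally have A: "x' * potential_dx p x \<xi> \<le> \<gamma> / 4 * w" using a by simp
  have "0 \<le> (\<eta> - \<gamma> / 2 * \<xi>)\<^sup>2" by simp
  then have "(\<eta> + \<gamma> / 2 * \<xi>)\<^sup>2 / 2 \<le> \<eta>\<^sup>2 + \<gamma>\<^sup>2 / 4 * \<xi>\<^sup>2"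
    by (simp add: power2_eq_square field_simps)
  then have "lyapunov p \<gamma> x \<xi> \<eta> \<le> \<eta>\<^sup>2 + 3 * \<gamma>\<^sup>2 / 8 * \<xi>\<^sup>2 + w"
    using potential_le_work[of p x \<xi>] by (simp add: lyapunov_def w_def)
  also have "\<dots> \<le> \<eta>\<^sup>2 + 3 * \<gamma>\<^sup>2 / 8 * (2 * w / a ^ (2*p)) + w"
    using xi by (intro add_mono mult_left_mono) auto
  also have "\<dots> = \<eta>\<^sup>2 + (3 * \<gamma>\<^sup>2 / 4 / a ^ (2*p) + 1) * w" by (simp add: algebra_simps)
  finally have "k * lyapunov p \<gamma> x \<xi> \<eta> \<le> k * (\<eta>\<^sup>2 + (3 * \<gamma>\<^sup>2 / 4 / a ^ (2*p) + 1) * w)"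
    using k by (intro mult_left_mono) auto
  also have "\<dots> = k * \<eta>\<^sup>2 + k * (3 * \<gamma>\<^sup>2 / 4 / a ^ (2*p) + 1) * w" by (simp add: algebra_simps)
  also have "\<dots> \<le> \<gamma> / 2 * \<eta>\<^sup>2 + \<gamma> / 4 * w"
    using k w0 by (intro add_mono mult_right_mono) auto
  finally show ?thesis using A unfolding w_def[symmetric] by linarith
qed

section \<open>Global solutions of Lipschitz equations\<close>

lemma integral_upper_limit_derivative:
  fixes h :: "real \<Rightarrow> 'a::banach"
  assumes h: "continuous_on {s..} h" and t: "s \<le> t"
  shows "((\<lambda>t. integral {s..t} h) has_vector_derivative h t) (at t within {s..})"
proof -
  have "continuous_on {s..t+1} h" by (rule continuous_on_subset[OF h]) auto
  then have "((\<lambda>t. integral {s..t} h) has_vector_derivative h t) (at t within {s..t+1})"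
    using t by (intro integral_has_vector_derivative) auto
  moreover have "at t within {s..t+1} = at t within {s..}"
    by (rule at_within_nhd[of _ "{..<t+1}"]) auto
  ultimately show ?thesis by simp
qed

lemma norm_integral_le_exp:
  fixes h :: "real \<Rightarrow> 'a::banach"
  assumes h: "continuous_on {s..} h" and t: "s \<le> t" and l: "0 < l" and C: "0 \<le> C"
    and b: "\<And>r. s \<le> r \<Longrightarrow> norm (h r) \<le> C * exp (l * (r - s))"
  shows "norm (integral {s..t} h) \<le> C / l * exp (l * (t - s))"
proof -
  have "((\<lambda>r. C * exp (l * (r - s))) has_integral
      C / l * exp (l * (t - s)) - C / l * exp (l * (s - s))) {s..t}"
    using l by (intro fundamental_theorem_of_calculus[OF t])
      (auto intro!: derivative_eq_intros simp flip: has_real_derivative_iff_has_vector_derivative)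
  moreover have "h integrable_on {s..t}"
    by (rule integrable_continuous_real[OF continuous_on_subset[OF h]]) auto
  ultimately have "norm (integral {s..t} h) \<le> C / l * exp (l * (t - s)) - C / l * exp (l * (s - s))"
    using b by (metis (no_types, lifting) atLeastAtMost_iff has_integral_integrable
        integral_norm_bound_integral integral_unique)
  moreover have "0 \<le> C / l * exp (l * (s - s))" using C l by simp
  ultimately show ?thesis by linarith
qed

text \<open>
  Picard iteration converges on the whole half-line at once when distances at time \<open>t\<close> are weighted
  with \<open>exp (- l (t - s))\<close>: integrating from \<open>s\<close> to \<open>t\<close> then gains a factor \<open>1 / l\<close>, and \<open>l = 2 L\<close> makes
  the integral operator a contraction with constant \<open>1 / 2\<close>.
\<close>
theorem global_solution_of_lipschitz_ode:
  fixes G :: "real \<Rightarrow> 'a::banach \<Rightarrow> 'a"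
  assumes cont: "continuous_on UNIV (\<lambda>(t, y). G t y)"
    and lip: "\<And>t y z. norm (G t y - G t z) \<le> L * norm (y - z)" and L: "0 < L"
    and bound: "\<And>t. norm (G t a) \<le> B"
  obtains y where "y s = a" "\<And>t. s \<le> t \<Longrightarrow> (y has_vector_derivative G t (y t)) (at t within {s..})"
proof -
  define l where "l = 2 * L"
  have l: "0 < l" using L by (simp add: l_def)
  have B: "0 \<le> B" using bound[of 0] norm_ge_zero order_trans by blast
  \<comment> \<open>The unknown is the bounded function \<open>u\<close> with \<open>y = a + exp (l (t - s)) u\<close>; the integral equation for
     \<open>y\<close> becomes \<open>u = P u\<close>. Freezing the time at \<open>s\<close> for \<open>t < s\<close> makes \<open>P u\<close> continuous on the line.\<close>
  define Y where "Y u t = a + exp (l * (t - s)) *\<^sub>R apply_bcontfun u t" for u t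
  define I where "I u t = integral {s..t} (\<lambda>r. G r (Y u r))" for u t
  define P where "P u t = exp (- l * (max s t - s)) *\<^sub>R I u (max s t)" for u t
  have contY: "continuous_on S (Y u)" for S u
    unfolding Y_def by (intro continuous_intros continuous_on_apply_bcontfun)
  have contG: "continuous_on S (\<lambda>r. G r (Y u r))" for S u
    using continuous_on_compose2[OF cont continuous_on_Pair[OF continuous_on_id contY]] by simp
  have derI: "(I u has_vector_derivative G t (Y u t)) (at t within {s..})" if "s \<le> t" for u t
    unfolding I_def by (rule integral_upper_limit_derivative[OF contG that])
  have contI: "continuous_on {s..} (I u)" for u
    using derI by (auto intro!: continuous_on_vector_derivative)
  have contP: "continuous_on UNIV (P u)" for u
    unfolding P_def
    by (intro continuous_intros continuous_on_compose2[OF contI]) auto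
  have scale: "norm (exp (- l * (t - s)) *\<^sub>R z) \<le> D" if "norm z \<le> D * exp (l * (t - s))" for t z D
    using that by (simp add: exp_minus inverse_eq_divide pos_divide_le_eq)
  have "norm (P u t) \<le> (B + L * norm u) / l" for u t
    unfolding P_def I_def
  proof (rule scale, rule norm_integral_le_exp[OF contG _ l])
    fix r assume r: "s \<le> r"
    have e: "1 \<le> exp (l * (r - s))" using r l by simp
    have "norm (G r (Y u r)) \<le> norm (G r (Y u r) - G r a) + norm (G r a)"
      using norm_triangle_ineq[of "G r (Y u r) - G r a" "G r a"] by simp
    also have "\<dots> \<le> L * (exp (l * (r - s)) * norm u) + B * exp (l * (r - s))"
    proof (rule add_mono)
      have "norm (G r (Y u r) - G r a) \<le> L * norm (Y u r - a)" by (rule lip)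
      also have "\<dots> \<le> L * (exp (l * (r - s)) * norm u)"
        using L by (simp add: Y_def norm_bounded)
      finally show "norm (G r (Y u r) - G r a) \<le> L * (exp (l * (r - s)) * norm u)" .
      show "norm (G r a) \<le> B * exp (l * (r - s))"
        using bound[of r] mult_left_mono[OF e B] by simp
    qed
    finally show "norm (G r (Y u r)) \<le> (B + L * norm u) * exp (l * (r - s))"
      by (simp add: algebra_simps)
  qed (use B L in auto)
  then have memP: "P u \<in> bcontfun" for u
    by (intro bcontfun_normI[OF contP])
  define T where "T u = Bcontfun (P u)" for u
  have T: "apply_bcontfun (T u) = P u" for u
    unfolding T_def by (rule Bcontfun_inverse[OF memP])
  have "dist (T u) (T v) \<le> 1 / 2 * dist u v" for u v
  proof (rule dist_bound)
    fix t
    define m where "m = max s t"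
    have m: "s \<le> m" by (simp add: m_def)
    have int: "(\<lambda>r. G r (Y u r)) integrable_on {s..m}" for u
      by (rule integrable_continuous_real[OF contG])
    have "norm (exp (- l * (m - s)) *\<^sub>R (I u m - I v m)) \<le> (L * dist u v) / l"
    proof (rule scale)
      have "I u m - I v m = integral {s..m} (\<lambda>r. G r (Y u r) - G r (Y v r))"
        unfolding I_def by (rule Henstock_Kurzweil_Integration.integral_diff[OF int int, symmetric])
      also have "norm \<dots> \<le> (L * dist u v) / l * exp (l * (m - s))"
      proof (rule norm_integral_le_exp[OF _ m l])
        show "continuous_on {s..} (\<lambda>r. G r (Y u r) - G r (Y v r))"
          by (intro continuous_intros contG)
        fix r
        have "norm (G r (Y u r) - G r (Y v r)) \<le> L * norm (Y u r - Y v r)" by (rule lip)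
        also have "Y u r - Y v r = exp (l * (r - s)) *\<^sub>R (apply_bcontfun u r - apply_bcontfun v r)"
          by (simp add: Y_def scaleR_diff_right)
        also have "L * norm \<dots> \<le> L * (exp (l * (r - s)) * dist u v)"
          using L dist_bounded[of u r v] by (simp add: dist_norm)
        finally show "norm (G r (Y u r) - G r (Y v r)) \<le> L * dist u v * exp (l * (r - s))"
          by (simp add: mult_ac)
      qed (use L in auto)
      finally show "norm (I u m - I v m) \<le> (L * dist u v) / l * exp (l * (m - s))" .
    qed
    then show "dist (apply_bcontfun (T u) t) (apply_bcontfun (T v) t) \<le> 1 / 2 * dist u v"
      using L by (simp add: T P_def m_def l_def dist_norm scaleR_diff_right)
  qed
  then obtain u where u: "T u = u"
    using banach_fix_type[of "1/2" T] by auto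
  have fix_eq: "Y u t = a + I u t" if "s \<le> t" for t
  proof -
    have "apply_bcontfun u t = P u t" using T[of u] u by simp
    then show ?thesis using that by (simp add: Y_def P_def flip: exp_add)
  qed
  show thesis
  proof (rule that)
    show "Y u s = a" using fix_eq[of s] by (simp add: I_def)
    fix t assume t: "s \<le> t"
    have "((\<lambda>t. a + I u t) has_vector_derivative G t (Y u t)) (at t within {s..})"
      using derI[OF t] by (auto intro!: derivative_eq_intros)
    then show "(Y u has_vector_derivative G t (Y u t)) (at t within {s..})"
      by (rule has_vector_derivative_transform[rotated 2]) (use t fix_eq in auto)
  qed
qed

section \<open>Asymptotic stability of the damped oscillator\<close>

text \<open>
  The equation of the deviation \<open>\<xi>\<close> from a reference motion \<open>x\<close> that stays away from 0 and moves
  slowly compared with the damping. The constant in the last condition is the one for which the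
  drift costs at most half of the dissipation.
\<close>
locale damped_oscillator =
  fixes p :: nat and \<gamma> a K :: real and x x' :: "real \<Rightarrow> real"
  assumes \<gamma>: "0 < \<gamma>" and a: "0 < a"
    and x_ge: "a \<le> \<bar>x t\<bar>" and x_le: "\<bar>x t\<bar> \<le> K"
    and x_deriv: "(x has_real_derivative x' t) (at t)"
    and x_slow: "8 * (real (2*p+1))\<^sup>2 * \<bar>x' t\<bar> \<le> a * \<gamma>"
begin

definition rate :: real where
  "rate = min (\<gamma> / 2) (\<gamma> / 4 / (3 * \<gamma>\<^sup>2 / 4 / a ^ (2*p) + 1))"

abbreviation V :: "real \<Rightarrow> real \<Rightarrow> real \<Rightarrow> real" where
  "V t \<xi> \<eta> \<equiv> lyapunov p \<gamma> (x t) \<xi> \<eta>"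

lemma rate: "0 < rate" "rate \<le> \<gamma> / 2" "rate * (3 * \<gamma>\<^sup>2 / 4 / a ^ (2*p) + 1) \<le> \<gamma> / 4"
proof -
  have q: "0 < 3 * \<gamma>\<^sup>2 / 4 / a ^ (2*p) + 1" using a by (intro add_nonneg_pos) auto
  show "0 < rate" using \<gamma> divide_pos_pos[OF _ q, of "\<gamma> / 4"] by (simp add: rate_def)
  show "rate \<le> \<gamma> / 2" by (simp only: rate_def min.cobounded1)
  have "rate \<le> \<gamma> / 4 / (3 * \<gamma>\<^sup>2 / 4 / a ^ (2*p) + 1)" by (simp only: rate_def min.cobounded2)
  then show "rate * (3 * \<gamma>\<^sup>2 / 4 / a ^ (2*p) + 1) \<le> \<gamma> / 4" by (simp only: pos_le_divide_eq[OF q])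
qed

lemma x_continuous: "continuous_on S x"
  using x_deriv by (meson DERIV_isCont continuous_at_imp_continuous_on)

text \<open>
  The equation is required only in the interior of the interval, so that the estimate applies up to
  the moment at which a solution leaves a region.
\<close>
lemma lyapunov_decay:
  assumes "s \<le> t" and cont: "continuous_on {s..t} \<xi>" "continuous_on {s..t} \<eta>"
    and \<xi>: "\<And>r. s < r \<Longrightarrow> r < t \<Longrightarrow> (\<xi> has_real_derivative \<eta> r) (at r)"
    and \<eta>: "\<And>r. s < r \<Longrightarrow> r < t \<Longrightarrow>
              (\<eta> has_real_derivative - \<gamma> * \<eta> r - restoring p (x r) (\<xi> r)) (at r)"
  shows "V t (\<xi> t) (\<eta> t) \<le> V s (\<xi> s) (\<eta> s) * exp (- rate * (t - s))"
proof -
  define W where "W r = exp (rate * (r - s)) * V r (\<xi> r) (\<eta> r)" for r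
  have "W t \<le> W s"
  proof (rule DERIV_nonpos_imp_decreasing_open[OF \<open>s \<le> t\<close>])
    fix r assume r: "s < r" "r < t"
    let ?D = "- (\<gamma> / 2) * (\<eta> r)\<^sup>2 - \<gamma> / 2 * (\<xi> r * restoring p (x r) (\<xi> r))
       + x' r * potential_dx p (x r) (\<xi> r)"
    have "((\<lambda>r. V r (\<xi> r) (\<eta> r)) has_real_derivative ?D) (at r)"
      by (rule lyapunov_has_derivative[where \<xi> = \<xi> and \<eta> = \<eta>, OF x_deriv \<xi>[OF r] \<eta>[OF r] refl])
    then have "(W has_real_derivative
        exp (rate * (r - s)) * (rate * V r (\<xi> r) (\<eta> r) + ?D)) (at r)"
      unfolding W_def by (auto intro!: derivative_eq_intros simp: algebra_simps)
    moreover have "?D \<le> - rate * V r (\<xi> r) (\<eta> r)"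
      using rate by (intro lyapunov_decay_rate[OF a x_ge \<gamma> x_slow]) auto
    then have "exp (rate * (r - s)) * (rate * V r (\<xi> r) (\<eta> r) + ?D) \<le> 0"
      by (intro mult_nonneg_nonpos) auto
    ultimately show "\<exists>y. (W has_real_derivative y) (at r) \<and> y \<le> 0" by blast
  next
    show "continuous_on {s..t} W"
      unfolding W_def lyapunov_def potential_def by (intro continuous_intros cont x_continuous) auto
  qed
  then show ?thesis by (simp add: W_def exp_minus inverse_eq_divide pos_le_divide_eq mult.commute)
qed

lemma position_le_lyapunov: "\<gamma>\<^sup>2 / 8 * \<xi>\<^sup>2 \<le> V t \<xi> \<eta>"
  and velocity_le_lyapunov: "(\<eta> + \<gamma> / 2 * \<xi>)\<^sup>2 / 2 \<le> V t \<xi> \<eta>"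
  using potential_nonneg[of p "x t" \<xi>] by (auto simp: lyapunov_def)

lemma trajectory_iff:
  "trajectory p \<gamma> x s \<xi> \<eta> \<longleftrightarrow>
     (\<forall>t\<ge>s. (\<xi> has_real_derivative \<eta> t) (at t within {s..}) \<and>
            (\<eta> has_real_derivative - \<gamma> * \<eta> t - restoring p (x t) (\<xi> t)) (at t within {s..}))"
proof -
  have "z + \<gamma> * \<eta> t + restoring p (x t) (\<xi> t) = 0 \<longleftrightarrow> z = - \<gamma> * \<eta> t - restoring p (x t) (\<xi> t)" for z t
    by auto
  then show ?thesis unfolding trajectory_def restoring_eq by auto
qed

lemma trajectory_lyapunov_decay:
  assumes "trajectory p \<gamma> x s \<xi> \<eta>" "s \<le> t"
  shows "V t (\<xi> t) (\<eta> t) \<le> V s (\<xi> s) (\<eta> s) * exp (- rate * (t - s))"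
proof (rule lyapunov_decay[OF \<open>s \<le> t\<close>])
  note d = assms(1)[unfolded trajectory_iff, rule_format]
  have c: "continuous_on {s..} \<xi>" "continuous_on {s..} \<eta>"
    using d by (auto intro!: DERIV_continuous_on)
  show "continuous_on {s..t} \<xi>" "continuous_on {s..t} \<eta>"
    by (rule continuous_on_subset[OF c(1)], simp, rule continuous_on_subset[OF c(2)], simp)
  fix r assume r: "s < r"
  then have "at r within {s..} = at r" by (intro at_within_interior) auto
  then show "(\<xi> has_real_derivative \<eta> r) (at r)"
    "(\<eta> has_real_derivative - \<gamma> * \<eta> r - restoring p (x r) (\<xi> r)) (at r)"
    using d[of r] r by auto
qed

theorem trajectory_converges:
  assumes "trajectory p \<gamma> x s \<xi> \<eta>"
  shows "((\<lambda>t. (\<xi> t, \<eta> t)) \<longlongrightarrow> (0, 0)) at_top"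
proof -
  define E where "E t = V s (\<xi> s) (\<eta> s) * exp (- rate * (t - s))" for t
  have E: "(E \<longlongrightarrow> 0) at_top"
    unfolding E_def using rate(1) by real_asymp
  have VE: "\<forall>\<^sub>F t in at_top. V t (\<xi> t) (\<eta> t) \<le> E t"
    using eventually_ge_at_top[of s] trajectory_lyapunov_decay[OF assms] unfolding E_def
    by (rule eventually_mono)
  have "((\<lambda>t. (\<xi> t)\<^sup>2) \<longlongrightarrow> 0) at_top"
  proof (rule tendsto_sandwich[of "\<lambda>_. 0"])
    show "\<forall>\<^sub>F t in at_top. (\<xi> t)\<^sup>2 \<le> 8 / \<gamma>\<^sup>2 * E t"
      using VE
    proof eventually_elim
      case (elim t)
      then show ?case using position_le_lyapunov[of "\<xi> t" t "\<eta> t"] \<gamma> by (simp add: field_simps)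
    qed
    show "((\<lambda>t. 8 / \<gamma>\<^sup>2 * E t) \<longlongrightarrow> 0) at_top"
      by (rule tendsto_mult_right_zero[OF E])
  qed simp_all
  then have \<xi>0: "(\<xi> \<longlongrightarrow> 0) at_top" by simp
  have "((\<lambda>t. (\<eta> t + \<gamma> / 2 * \<xi> t)\<^sup>2) \<longlongrightarrow> 0) at_top"
  proof (rule tendsto_sandwich[of "\<lambda>_. 0"])
    show "\<forall>\<^sub>F t in at_top. (\<eta> t + \<gamma> / 2 * \<xi> t)\<^sup>2 \<le> 2 * E t"
      using VE
    proof eventually_elim
      case (elim t)
      then show ?case using velocity_le_lyapunov[of "\<eta> t" "\<xi> t" t] by simp
    qed
    show "((\<lambda>t. 2 * E t) \<longlongrightarrow> 0) at_top"
      by (rule tendsto_mult_right_zero[OF E])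
  qed simp_all
  then have "((\<lambda>t. \<eta> t + \<gamma> / 2 * \<xi> t) \<longlongrightarrow> 0) at_top" by simp
  from tendsto_diff[OF this tendsto_mult_right_zero[OF \<xi>0, of "\<gamma> / 2"]]
  have "(\<eta> \<longlongrightarrow> 0) at_top" by simp
  with \<xi>0 show ?thesis by (rule tendsto_Pair)
qed

theorem trajectory_exists:
  "\<exists>\<xi> \<eta>. trajectory p \<gamma> x s \<xi> \<eta> \<and> \<xi> s = \<xi>0 \<and> \<eta> s = \<eta>0"
proof -
  define V0 where "V0 = V s \<xi>0 \<eta>0"
  have V0: "0 \<le> V0" using position_le_lyapunov[of \<xi>0 s \<eta>0] unfolding V0_def
    by (rule order_trans[rotated]) simp
  obtain R where R: "0 < R" "V0 < \<gamma>\<^sup>2 / 8 * R\<^sup>2"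
  proof
    show "0 < sqrt (8 * V0 / \<gamma>\<^sup>2 + 1)" using V0 by (intro real_sqrt_gt_zero add_nonneg_pos) auto
    show "V0 < \<gamma>\<^sup>2 / 8 * (sqrt (8 * V0 / \<gamma>\<^sup>2 + 1))\<^sup>2"
      using V0 \<gamma> by (simp add: field_simps)
  qed
  \<comment> \<open>The equation with the cut-off position \<open>cl \<xi>\<close> in the force. \<open>R\<close> is so large that a position of
     that size has a larger \<open>V\<close> than the initial state.\<close>
  define cl where "cl u = max (- R) (min R u)" for u
  have cl_le: "\<bar>cl u\<bar> \<le> R" for u using R by (auto simp: cl_def)
  have cl_id: "cl u = u" if "\<bar>u\<bar> \<le> R" for u using that by (auto simp: cl_def)
  have cl_lip: "\<bar>cl u - cl v\<bar> \<le> \<bar>u - v\<bar>" for u v by (auto simp: cl_def)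
  define M where "M = real (2*p+1) * (K + R) ^ (2*p)"
  have M: "0 \<le> M" using R x_le[of 0] unfolding M_def by (intro mult_nonneg_nonneg) auto
  have g_lip: "\<bar>restoring p (x t) (cl u) - restoring p (x t) (cl v)\<bar> \<le> M * \<bar>u - v\<bar>" for t u v
    using restoring_lipschitz[where p = p, OF x_le[of t] cl_le[of u] cl_le[of v]] mult_left_mono[OF cl_lip M, of u v]
    unfolding M_def by linarith
  define G where "G t y = (snd y, - \<gamma> * snd y - restoring p (x t) (cl (fst y)))" for t and y :: "real \<times> real"
  obtain y where y0: "y s = (\<xi>0, \<eta>0)"
    and y: "\<And>t. s \<le> t \<Longrightarrow> (y has_vector_derivative G t (y t)) (at t within {s..})"
  proof (rule global_solution_of_lipschitz_ode[where s = s])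
    show "continuous_on UNIV (\<lambda>(t, y). G t y)"
      unfolding G_def restoring_def cl_def case_prod_beta
      by (intro continuous_intros continuous_on_compose2[OF x_continuous[of UNIV]]) auto
    show "0 < 1 + \<gamma> + M" using \<gamma> M by simp
    fix t and y z :: "real \<times> real"
    have f: "\<bar>fst y - fst z\<bar> \<le> norm (y - z)" and s: "\<bar>snd y - snd z\<bar> \<le> norm (y - z)"
      using norm_fst_le[of "fst y - fst z" "snd y - snd z"] norm_snd_le[of "snd y - snd z" "fst y - fst z"]
      by (simp_all flip: fst_diff snd_diff)
    have "norm (G t y - G t z) \<le> \<bar>snd y - snd z\<bar> + 
        \<bar>\<gamma> * (snd y - snd z) + (restoring p (x t) (cl (fst y)) - restoring p (x t) (cl (fst z)))\<bar>"
      unfolding G_def by (rule order_trans[OF _ order_trans[OF norm_Pair_le]])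
        (auto simp: algebra_simps)
    also have "\<dots> \<le> \<bar>snd y - snd z\<bar> + (\<gamma> * \<bar>snd y - snd z\<bar> + M * \<bar>fst y - fst z\<bar>)"
      using g_lip[of t "fst y" "fst z"] \<gamma> 
      by (intro add_left_mono order_trans[OF abs_triangle_ineq] add_mono) (auto simp: abs_mult)
    also have "\<dots> \<le> norm (y - z) + (\<gamma> * norm (y - z) + M * norm (y - z))"
      using f s \<gamma> M by (intro add_mono mult_left_mono) auto
    finally show "norm (G t y - G t z) \<le> (1 + \<gamma> + M) * norm (y - z)"
      by (simp add: algebra_simps)
    have "\<bar>restoring p (x t) (cl \<xi>0)\<bar> \<le> M * \<bar>\<xi>0\<bar>"
      using g_lip[of t \<xi>0 0] R by (simp add: cl_id restoring_def)
    then show "norm (G t (\<xi>0, \<eta>0)) \<le> \<bar>\<eta>0\<bar> + (\<gamma> * \<bar>\<eta>0\<bar> + M * \<bar>\<xi>0\<bar>)"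
      unfolding G_def fst_conv snd_conv using \<gamma> 
      by (intro order_trans[OF norm_Pair_le] add_mono)
        (auto simp: abs_mult intro!: order_trans[OF abs_triangle_ineq4])
  next
    fix y
    assume "y s = (\<xi>0, \<eta>0)"
      and "\<And>t. s \<le> t \<Longrightarrow> (y has_vector_derivative G t (y t)) (at t within {s..})"
    then show thesis by (rule that)
  qed
  define \<xi> where "\<xi> t = fst (y t)" for t
  define \<eta> where "\<eta> t = snd (y t)" for t
  have d\<xi>: "(\<xi> has_real_derivative \<eta> t) (at t within {s..})" if "s \<le> t" for t
    using bounded_linear.has_vector_derivative[OF bounded_linear_fst y[OF that]]
    by (simp add: \<xi>_def[abs_def] \<eta>_def G_def has_real_derivative_iff_has_vector_derivative)
  have d\<eta>: "(\<eta> has_real_derivative - \<gamma> * \<eta> t - restoring p (x t) (cl (\<xi> t))) (at t within {s..})"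
    if "s \<le> t" for t
    using bounded_linear.has_vector_derivative[OF bounded_linear_snd y[OF that]]
    by (simp add: \<xi>_def \<eta>_def[abs_def] G_def has_real_derivative_iff_has_vector_derivative)
  have cont: "continuous_on {s..} \<xi>" "continuous_on {s..} \<eta>"
    using d\<xi> d\<eta> by (auto intro!: DERIV_continuous_on)
  have bound: "\<bar>\<xi> t\<bar> < R" if t: "s \<le> t" for t
  proof (rule ccontr)
    assume "\<not> \<bar>\<xi> t\<bar> < R"
    \<comment> \<open>Up to the first time \<open>r\<close> at which \<open>\<bar>\<xi>\<bar>\<close> reaches \<open>R\<close> the original equation holds, and \<open>V\<close> decays.\<close>
    define S where "S = {r \<in> {s..t}. R \<le> \<bar>\<xi> r\<bar>}"
    have "closed S"
      unfolding S_def using continuous_on_subset[OF cont(1), of "{s..t}"]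
      by (intro continuous_on_closed_Collect_le continuous_intros) auto
    moreover have "S = {s..t} \<inter> S" by (auto simp: S_def)
    ultimately have "compact S" using compact_Int_closed[OF compact_Icc[of s t]] by metis
    moreover have "S \<noteq> {}" using t \<open>\<not> \<bar>\<xi> t\<bar> < R\<close> by (auto simp: S_def)
    ultimately have "\<exists>r\<in>S. \<forall>q\<in>S. r \<le> q" by (rule compact_attains_inf)
    then obtain r where r: "r \<in> S" "\<And>q. q \<in> S \<Longrightarrow> r \<le> q" by blast
    have sr: "s \<le> r" and \<xi>r: "R \<le> \<bar>\<xi> r\<bar>" using r(1) by (auto simp: S_def)
    have inside: "\<bar>\<xi> q\<bar> \<le> R" if "s < q" "q < r" for q
    proof (rule ccontr)
      assume "\<not> \<bar>\<xi> q\<bar> \<le> R"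
      then have "q \<in> S" using that r(1) by (simp add: S_def)
      then show False using r(2)[of q] that by simp
    qed
    have "V r (\<xi> r) (\<eta> r) \<le> V s (\<xi> s) (\<eta> s) * exp (- rate * (r - s))"
    proof (rule lyapunov_decay[OF sr])
      show "continuous_on {s..r} \<xi>" "continuous_on {s..r} \<eta>"
        by (rule continuous_on_subset[OF cont(1)], simp, rule continuous_on_subset[OF cont(2)], simp)
      fix q assume q: "s < q" "q < r"
      have "at q within {s..} = at q" using q by (intro at_within_interior) auto
      then show "(\<xi> has_real_derivative \<eta> q) (at q)"
        "(\<eta> has_real_derivative - \<gamma> * \<eta> q - restoring p (x q) (\<xi> q)) (at q)"
        using d\<xi>[of q] d\<eta>[of q] q cl_id[OF inside[OF q]] by auto
    qed
    also have "\<dots> \<le> V0"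
      using V0 sr rate(1) by (simp add: V0_def \<xi>_def \<eta>_def y0 mult_left_le)
    also have "\<dots> < \<gamma>\<^sup>2 / 8 * R\<^sup>2" by (rule R(2))
    also have "\<dots> \<le> \<gamma>\<^sup>2 / 8 * (\<xi> r)\<^sup>2"
      using \<xi>r R(1) by (intro mult_left_mono) (simp_all add: abs_le_square_iff[symmetric])
    also have "\<dots> \<le> V r (\<xi> r) (\<eta> r)" by (rule position_le_lyapunov)
    finally show False by simp
  qed
  have "trajectory p \<gamma> x s \<xi> \<eta>"
    unfolding trajectory_iff
  proof (intro allI impI conjI)
    fix t assume t: "s \<le> t"
    show "(\<xi> has_real_derivative \<eta> t) (at t within {s..})" by (rule d\<xi>[OF t])
    show "(\<eta> has_real_derivative - \<gamma> * \<eta> t - restoring p (x t) (\<xi> t)) (at t within {s..})"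
      using d\<eta>[OF t] by (simp only: cl_id[OF less_imp_le[OF bound[OF t]]])
  qed
  moreover have "\<xi> s = \<xi>0" "\<eta> s = \<eta>0" by (simp_all add: \<xi>_def \<eta>_def y0)
  ultimately show ?thesis by blast
qed

end

section \<open>Stability of the quasi-periodic solution\<close>

theorem theorem2:
  fixes p :: nat
    and f :: "real ^ 'n \<Rightarrow> real"
    and c :: "int ^ 'n \<Rightarrow> complex"
    and \<omega> :: "real ^ 'n"
    and C0 \<tau> \<alpha> \<gamma>0 :: real
    and x0 :: "real \<Rightarrow> real \<Rightarrow> real"
  assumes "analytic_forcing f c"
    and "c 0 \<noteq> 0"
    and "C0 > 0"
    and "\<tau> > real CARD('n) - 1"
    and "diophantine \<omega> C0 \<tau>"
    and "\<alpha> = root (2 * p + 1) (Re (c 0))"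
    and "\<gamma>0 > 0"
    and "\<And>\<gamma>. \<gamma> > \<gamma>0 \<Longrightarrow> forced_solution p \<gamma> (\<lambda>t. f (t *\<^sub>R \<omega>)) (x0 \<gamma>)"
    and "\<And>\<gamma>. \<gamma> > \<gamma>0 \<Longrightarrow> quasi_periodic \<omega> (x0 \<gamma>)"
    and "\<exists>K. \<forall>\<^sub>F \<gamma> in at_top. \<forall>t. \<bar>x0 \<gamma> t - \<alpha>\<bar> \<le> K / \<gamma>"
    and "extends_analytically \<gamma>0 x0"
  shows "\<exists>\<gamma>1>0. \<forall>\<gamma>>\<gamma>1. \<forall>s.
           (\<forall>a b. \<exists>\<xi> \<eta>. trajectory p \<gamma> (x0 \<gamma>) s \<xi> \<eta> \<and> \<xi> s = a \<and> \<eta> s = b) \<and>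
           (\<forall>\<xi> \<eta>. trajectory p \<gamma> (x0 \<gamma>) s \<xi> \<eta> \<longrightarrow>
                  ((\<lambda>t. (\<xi> t, \<eta> t)) \<longlongrightarrow> (0, 0)) at_top)"
proof -
  have "c 0 \<in> \<real>" by (rule forcing_average_real[OF assms(1,5,3)])
  then have "Re (c 0) \<noteq> 0" using assms(2) by (auto simp: complex_is_Real_iff complex_eq_iff)
  then have "\<alpha> \<noteq> 0" using assms(6) by simp
  define a where "a = \<bar>\<alpha>\<bar> / 2"
  have a: "0 < a" using \<open>\<alpha> \<noteq> 0\<close> by (simp add: a_def)
  obtain B where B: "\<And>\<psi>. \<bar>f \<psi>\<bar> \<le> B" using analytic_forcing_bounded[OF assms(1)] by blast
  define M where "M = B + (3 * a) ^ (2*p+1)"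
  define D where "D = 8 * (real (2*p+1))\<^sup>2 * M"
  have "0 \<le> B" using B[of 0] by linarith
  then have D: "0 \<le> D" using a by (simp add: D_def M_def)
  obtain K N where N: "\<And>\<gamma> t. N \<le> \<gamma> \<Longrightarrow> \<bar>x0 \<gamma> t - \<alpha>\<bar> \<le> K / \<gamma>"
    using assms(10) by (auto simp: eventually_at_top_linorder)
  \<comment> \<open>\<open>K / a\<close> keeps \<open>x0\<close> within \<open>\<bar>\<alpha>\<bar> / 2\<close> of \<open>\<alpha>\<close>; 1 and \<open>D / a\<close> make it slow enough.\<close>
  define \<gamma>1 where "\<gamma>1 = Max {\<gamma>0, N, 1, K / a, D / a}"
  have osc: "\<exists>x'. damped_oscillator p \<gamma> a (3 * a) (x0 \<gamma>) x'" if "\<gamma> > \<gamma>1" for \<gamma>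
  proof -
    have \<gamma>: "\<gamma> > \<gamma>0" "N \<le> \<gamma>" "1 \<le> \<gamma>" "K / a \<le> \<gamma>" "D / a \<le> \<gamma>"
      using that by (auto simp: \<gamma>1_def)
    obtain x' x'' where d: "\<And>t. (x0 \<gamma> has_real_derivative x' t) (at t)"
        "\<And>t. (x' has_real_derivative x'' t) (at t)"
      and eq: "\<And>t. x'' t + \<gamma> * x' t + x0 \<gamma> t ^ (2*p+1) = f (t *\<^sub>R \<omega>)"
      using assms(8)[OF \<gamma>(1)] unfolding forced_solution_def by auto
    have "K / \<gamma> \<le> a" using \<gamma> a by (simp add: field_simps)
    then have near: "\<bar>x0 \<gamma> t - \<alpha>\<bar> \<le> a" for t using N[OF \<gamma>(2), of t] by linarith
    have x: "a \<le> \<bar>x0 \<gamma> t\<bar>" "\<bar>x0 \<gamma> t\<bar> \<le> 3 * a" for t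
      using near[of t] by (auto simp: a_def abs_if split: if_splits)
    have slow: "\<bar>x' t\<bar> \<le> M / \<gamma>" for t
    proof (rule damped_velocity_bound[OF _ d(1)])
      show "0 < \<gamma>" using \<gamma> by simp
      show "\<bar>x0 \<gamma> t\<bar> \<le> 3 * a" for t by (rule x)
      show "(x' has_real_derivative (f (t *\<^sub>R \<omega>) - x0 \<gamma> t ^ (2*p+1)) - \<gamma> * x' t) (at t)" for t
        by (rule DERIV_cong[OF d(2)]) (use eq[of t] in linarith)
      fix t
      have "\<bar>x0 \<gamma> t\<bar> ^ (2*p+1) \<le> (3 * a) ^ (2*p+1)" by (intro power_mono x) simp
      then show "\<bar>f (t *\<^sub>R \<omega>) - x0 \<gamma> t ^ (2*p+1)\<bar> \<le> M"
        using B[of "t *\<^sub>R \<omega>"] abs_triangle_ineq4[of "f (t *\<^sub>R \<omega>)" "x0 \<gamma> t ^ (2*p+1)"]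
        unfolding M_def power_abs[symmetric] by linarith
    qed
    have "damped_oscillator p \<gamma> a (3 * a) (x0 \<gamma>) x'"
    proof
      fix t
      have "8 * (real (2*p+1))\<^sup>2 * \<bar>x' t\<bar> \<le> 8 * (real (2*p+1))\<^sup>2 * (M / \<gamma>)"
        by (intro mult_left_mono slow) auto
      also have "\<dots> = D / \<gamma>" by (simp add: D_def)
      also have "\<dots> \<le> D" using D \<gamma>(3) by (simp add: divide_le_eq mult_le_cancel_left1)
      also have "\<dots> \<le> a * \<gamma>" using \<gamma>(5) a by (simp add: field_simps)
      finally show "8 * (real (2*p+1))\<^sup>2 * \<bar>x' t\<bar> \<le> a * \<gamma>" .
    qed (use \<gamma> a x d in auto)
    then show ?thesis by blast
  qed
  have "0 < \<gamma>1" using assms(7) by (auto simp: \<gamma>1_def less_max_iff_disj)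
  then show ?thesis
    using osc damped_oscillator.trajectory_exists damped_oscillator.trajectory_converges by blast
qed

end
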